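(* Let $\gamma\ge0$, let $d\ge 1$ be fixed, and let $(\mathbf X,\mathbf Y)$ be a random element of $\mathbb R^d\times\{0,1\}^d$ with $Y_1,\dots,Y_d$ conditionally independent given $\mathbf X$, $p_j(\mathbf x)=\mathbb P(Y_j=1\mid\mathbf X=\mathbf x)$, $\mathbf p=(p_1,\dots,p_d)$, the $p_j(\mathbf X)$ being pairwise distinct with probability one. Let $\widehat{\mathbf q}$ and $\widehat{\boldsymbol\delta}$ be the probability estimate and the segmentation rule obtained by the RankDice framework from a training sample of size $n$, and suppose that for a sequence of positive numbers $\epsilon_n$, $$\mathcal E_{\mathrm{CE}}(\widehat{\mathbf q}):=\mathbb E\big(l_{\mathrm{CE}}(\mathbf Y,\widehat{\mathbf q}(\mathbf X))\big)-\mathbb E\big(l_{\mathrm{CE}}(\mathbf Y,\mathbf p(\mathbf X))\big)=O_P(\epsilon_n).$$ Then $$\mathrm{Dice}_\gamma(\boldsymbol\delta^* )-\mathrm{Dice}_\gamma(\widehat{\boldsymbol\delta})=O_P\big(\sqrt d\,\epsilon_n^{1/2}\big),$$ where $\boldsymbol\delta^*$ is the Bayes rule for Dice-segmentation.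
   Context: For measurable $\boldsymbol\delta:\mathbb R^d\to\{0,1\}^d$, $$\mathrm{Dice}_\gamma(\boldsymbol\delta)=\mathbb E\Big(\frac{2\mathbf Y^\top\boldsymbol\delta(\mathbf X)+\gamma}{\|\mathbf Y\|_1+\|\boldsymbol\delta(\mathbf X)\|_1+\gamma}\Big),\qquad 0/0:=0,$$ and the Bayes rule $\boldsymbol\delta^*$ is a global maximizer of $\mathrm{Dice}_\gamma$ over all such $\boldsymbol\delta$. The cross-entropy loss is $l_{\mathrm{CE}}(\mathbf y,\mathbf q)=-\sum_{j=1}^d\big(y_j\log q_j+(1-y_j)\log(1-q_j)\big)$. Expectations in $\mathcal E_{\mathrm{CE}}(\widehat{\mathbf q})$ and $\mathrm{Dice}_\gamma(\widehat{\boldsymbol\delta})$ are over $(\mathbf X,\mathbf Y)$ independent of the training sample, with $\widehat{\mathbf q},\widehat{\boldsymbol\delta}$ held fixed; $O_P$ refers to the randomness of the training sample as $n\to\infty$. RankDice framework, given training data $(\mathbf x_i,\mathbf y_i)_{i=1}^n$. (Step 1) $\widehat{\mathbf q}\in\operatorname{argmin}_{\mathbf q\in\mathcal Q}\sum_{i=1}^n l_{\mathrm{CE}}(\mathbf y_i,\mathbf q(\mathbf x_i))+\lambda\|\mathbf q\|^2$, where $\mathcal Q$ is a class of measurable candidate functions $\mathbb R^d\to[0,1]^d$, $\|\mathbf q\|$ a regularization term, $\lambda>0$. (Step 2) For each $\mathbf x$, order indices so that $\widehat q_{j_1}(\mathbf x)\ge\cdots\ge\widehat q_{j_d}(\mathbf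 x)$. (Step 3) Let $$\widehat\tau(\mathbf x)\in\operatorname*{argmax}_{\tau\in\{0,\dots,d\}}\ \sum_{s=1}^\tau\sum_{l=0}^{d-1}\frac{2}{\tau+l+\gamma+1}\widehat q_{j_s}(\mathbf x)\mathbb P\big(\widehat\Gamma_{-j_s}(\mathbf x)=l\big)+\sum_{l=0}^d\frac{\gamma}{\tau+l+\gamma}\mathbb P\big(\widehat\Gamma(\mathbf x)=l\big),$$ where $\widehat\Gamma(\mathbf x)=\sum_{j=1}^d\widehat B_j(\mathbf x)$, $\widehat\Gamma_{-j}(\mathbf x)=\sum_{j'\ne j}\widehat B_{j'}(\mathbf x)$ and $\widehat B_j(\mathbf x)$ are independent Bernoulli variables with success probabilities $\widehat q_j(\mathbf x)$. Output: $\widehat\delta_j(\mathbf x)=1$ if $j\in\{j_1,\dots,j_{\widehat\tau(\mathbf x)}\}$ and $0$ otherwise (ties broken by any fixed measurable rule). *)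

theory Defs
  imports "HOL-Probability.Probability"
begin

text \<open>
  The dimension is the cardinality of the index type \<open>'d\<close>. Both feature vectors and
  \<open>{0,1}\<close>-valued vectors are elements of \<^typ>\<open>real ^ 'd\<close>, the latter restricted to \<open>binary_vecs\<close>.
\<close>

definition binary_vecs :: "(real ^ 'd) set" where
  "binary_vecs = {y. \<forall>j. y $ j = 0 \<or> y $ j = 1}"

definition norm1 :: "real ^ 'd \<Rightarrow> real" where
  "norm1 y = (\<Sum>j\<in>UNIV. \<bar>y $ j\<bar>)"

definition gen_sigma :: "'a measure \<Rightarrow> ('a \<Rightarrow> 'b::topological_space) \<Rightarrow> 'a measure" where
  "gen_sigma M X = vimage_algebra (space M) X borel"

definition prob_given :: "'a measure \<Rightarrow> 'a measure \<Rightarrow> 'a set \<Rightarrow> 'a \<Rightarrow> real" where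
  "prob_given M F B = real_cond_exp M F (indicator B)"

definition cond_indep_vars ::
    "'a measure \<Rightarrow> 'a measure \<Rightarrow> ('i \<Rightarrow> 'b measure) \<Rightarrow> ('i \<Rightarrow> 'a \<Rightarrow> 'b) \<Rightarrow> 'i set \<Rightarrow> bool" where
  "cond_indep_vars M F N Y I \<longleftrightarrow>
     (\<forall>i\<in>I. Y i \<in> measurable M (N i)) \<and>
     (\<forall>J\<subseteq>I. J \<noteq> {} \<longrightarrow> finite J \<longrightarrow> (\<forall>A\<in>(\<Pi> j\<in>J. sets (N j)).
        AE \<omega> in M. prob_given M F {w \<in> space M. \<forall>j\<in>J. Y j w \<in> A j} \<omega>
                  = (\<Prod>j\<in>J. prob_given M F {w \<in> space M. Y j w \<in> A j} \<omega>)))"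

definition cond_prob_version ::
    "'a measure \<Rightarrow> ('a \<Rightarrow> real ^ 'd) \<Rightarrow> ('a \<Rightarrow> real ^ 'd) \<Rightarrow> (real ^ 'd \<Rightarrow> real ^ 'd) \<Rightarrow> bool" where
  "cond_prob_version M X Y p \<longleftrightarrow>
     p \<in> borel_measurable borel \<and>
     (\<forall>j. AE \<omega> in M. p (X \<omega>) $ j
            = prob_given M (gen_sigma M X) {w \<in> space M. Y w $ j = 1} \<omega>)"

definition seg_rules :: "(real ^ 'd::finite \<Rightarrow> real ^ 'd) set" where
  "seg_rules = {\<delta> \<in> borel_measurable borel. \<forall>x. \<delta> x \<in> binary_vecs}"

text \<open>The convention \<open>0/0 := 0\<close> is the one of division on \<^typ>\<open>real\<close>.\<close>

definition Dice ::
    "real \<Rightarrow> 'a measure \<Rightarrow> ('a \<Rightarrow> real ^ 'd::finite) \<Rightarrow> ('a \<Rightarrow> real ^ 'd) \<Rightarrow> (real ^ 'd \<Rightarrow> real ^ 'd) \<Rightarrow> real" where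
  "Dice \<gamma> M X Y \<delta> =
     (\<integral>\<omega>. (2 * (Y \<omega> \<bullet> \<delta> (X \<omega>)) + \<gamma>) / (norm1 (Y \<omega>) + norm1 (\<delta> (X \<omega>)) + \<gamma>) \<partial>M)"

definition bayes_rule ::
    "real \<Rightarrow> 'a measure \<Rightarrow> ('a \<Rightarrow> real ^ 'd::finite) \<Rightarrow> ('a \<Rightarrow> real ^ 'd) \<Rightarrow> (real ^ 'd \<Rightarrow> real ^ 'd) \<Rightarrow> bool" where
  "bayes_rule \<gamma> M X Y \<delta> \<longleftrightarrow> is_arg_max (Dice \<gamma> M X Y) (\<lambda>\<delta>'. \<delta>' \<in> seg_rules) \<delta>"

text \<open>
  Since \<open>ln 0 = 0\<close> on \<^typ>\<open>real\<close>, the loss uses an extended logarithm with value \<open>-\<infinity>\<close> at \<open>0\<close>.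
  On \<^typ>\<open>ereal\<close> one has \<open>0 * (-\<infinity>) = 0\<close>, the usual convention \<open>0 log 0 = 0\<close>.
\<close>

definition elog :: "real \<Rightarrow> ereal" where
  "elog t = (if 0 < t then ereal (ln t) else -\<infinity>)"

definition ce_loss :: "real ^ 'd \<Rightarrow> real ^ 'd \<Rightarrow> ereal" where
  "ce_loss y q =
     - (\<Sum>j\<in>UNIV. ereal (y $ j) * elog (q $ j) + ereal (1 - y $ j) * elog (1 - q $ j))"

text \<open>
  The loss is nonnegative for \<open>y\<close> in \<open>{0,1}^d\<close> and \<open>q\<close> in \<open>[0,1]^d\<close>, so its expectation, possibly
  \<open>\<infinity>\<close>, is a nonnegative integral.
\<close>

definition ce_risk ::
    "'a measure \<Rightarrow> ('a \<Rightarrow> real ^ 'd) \<Rightarrow> ('a \<Rightarrow> real ^ 'd) \<Rightarrow> (real ^ 'd \<Rightarrow> real ^ 'd) \<Rightarrow> ereal" where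
  "ce_risk M X Y q = enn2ereal (\<integral>\<^sup>+\<omega>. e2ennreal (ce_loss (Y \<omega>) (q (X \<omega>))) \<partial>M)"

definition ce_excess ::
    "'a measure \<Rightarrow> ('a \<Rightarrow> real ^ 'd) \<Rightarrow> ('a \<Rightarrow> real ^ 'd) \<Rightarrow> (real ^ 'd \<Rightarrow> real ^ 'd) \<Rightarrow> (real ^ 'd \<Rightarrow> real ^ 'd) \<Rightarrow> ereal" where
  "ce_excess M X Y p q = ce_risk M X Y q - ce_risk M X Y p"

definition candidates :: "(real ^ 'd::finite \<Rightarrow> real ^ 'd) set" where
  "candidates = {q \<in> borel_measurable borel. \<forall>x j. 0 \<le> q x $ j \<and> q x $ j \<le> 1}"

definition train_objective ::
    "((real ^ 'd \<Rightarrow> real ^ 'd) \<Rightarrow> real) \<Rightarrow> real \<Rightarrow> nat \<Rightarrow> (nat \<Rightarrow> real ^ 'd) \<Rightarrow> (nat \<Rightarrow> real ^ 'd)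
      \<Rightarrow> (real ^ 'd \<Rightarrow> real ^ 'd) \<Rightarrow> ereal" where
  "train_objective pen lam n xs ys q =
     (\<Sum>i = 1..n. ce_loss (ys i) (q (xs i))) + ereal (lam * (pen q)\<^sup>2)"

text \<open>\<open>sum_bernoulli A q\<close> is the law of the sum of independent Bernoulli variables with success
  probabilities \<open>q $ j\<close>, \<open>j \<in> A\<close>.\<close>

definition sum_bernoulli :: "'d set \<Rightarrow> real ^ 'd \<Rightarrow> nat pmf" where
  "sum_bernoulli A q =
     map_pmf (\<lambda>b. \<Sum>j\<in>A. of_bool (b j)) (Pi_pmf A False (\<lambda>j. bernoulli_pmf (q $ j)))"

definition ranking :: "real ^ 'd \<Rightarrow> (nat \<Rightarrow> 'd) \<Rightarrow> bool" where
  "ranking q r \<longleftrightarrow>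
     bij_betw r {1..CARD('d)} UNIV \<and>
     (\<forall>s t. 1 \<le> s \<longrightarrow> s \<le> t \<longrightarrow> t \<le> CARD('d) \<longrightarrow> q $ r t \<le> q $ r s)"

definition volume_objective :: "real \<Rightarrow> real ^ 'd \<Rightarrow> (nat \<Rightarrow> 'd) \<Rightarrow> nat \<Rightarrow> real" where
  "volume_objective \<gamma> q r \<tau> =
     (\<Sum>s = 1..\<tau>. \<Sum>l = 0..CARD('d) - 1.
        2 / (real \<tau> + real l + \<gamma> + 1) * q $ r s * pmf (sum_bernoulli (UNIV - {r s}) q) l)
     + (\<Sum>l = 0..CARD('d). \<gamma> / (real \<tau> + real l + \<gamma>) * pmf (sum_bernoulli UNIV q) l)"

text \<open>The functions \<open>r\<close> and \<open>\<tau>\<close> are arbitrary measurable selections, which covers every measurable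
  rule for breaking ties, both in the ranking and in the choice of the maximizing volume.\<close>

definition rankdice_rule ::
    "real \<Rightarrow> (real ^ 'd::finite \<Rightarrow> real ^ 'd) \<Rightarrow> (real ^ 'd \<Rightarrow> real ^ 'd) \<Rightarrow> bool" where
  "rankdice_rule \<gamma> q \<delta> \<longleftrightarrow>
     (\<exists>r \<tau>. (\<forall>s\<in>{1..CARD('d)}. (\<lambda>x. r x s) \<in> measurable borel (count_space UNIV)) \<and>
            \<tau> \<in> measurable borel (count_space UNIV) \<and>
            (\<forall>x. ranking (q x) (r x)) \<and>
            (\<forall>x. is_arg_max (volume_objective \<gamma> (q x) (r x)) (\<lambda>t. t \<in> {0..CARD('d)}) (\<tau> x)) \<and>
            \<delta> = (\<lambda>x. \<chi> j. if j \<in> r x ` {1..\<tau> x} then 1 else 0))"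

definition rankdice ::
    "real \<Rightarrow> (real ^ 'd::finite \<Rightarrow> real ^ 'd) set \<Rightarrow> ((real ^ 'd \<Rightarrow> real ^ 'd) \<Rightarrow> real) \<Rightarrow> real
      \<Rightarrow> nat \<Rightarrow> (nat \<Rightarrow> real ^ 'd) \<Rightarrow> (nat \<Rightarrow> real ^ 'd)
      \<Rightarrow> (real ^ 'd \<Rightarrow> real ^ 'd) \<Rightarrow> (real ^ 'd \<Rightarrow> real ^ 'd) \<Rightarrow> bool" where
  "rankdice \<gamma> Q pen lam n xs ys q \<delta> \<longleftrightarrow>
     is_arg_min (train_objective pen lam n xs ys) (\<lambda>q'. q' \<in> Q) q \<and> rankdice_rule \<gamma> q \<delta>"

text \<open>
  \<open>Z n = O_P(a n)\<close>: for every \<open>\<eta> > 0\<close> there is \<open>C > 0\<close> such that \<open>P(|Z n| > C * a n) \<le> \<eta>\<close> for all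
  large \<open>n\<close>. The probability is an outer one, i.e. the exceptional set is contained in an event of
  probability at most \<open>\<eta>\<close>; for measurable \<open>Z n\<close> this is the usual notion.
\<close>

definition big_OP :: "'s measure \<Rightarrow> (nat \<Rightarrow> 's \<Rightarrow> ereal) \<Rightarrow> (nat \<Rightarrow> real) \<Rightarrow> bool" where
  "big_OP S Z a \<longleftrightarrow>
     (\<forall>\<eta>>0. \<exists>C>0. \<forall>\<^sub>F n in sequentially.
        \<exists>A\<in>sets S. {\<omega> \<in> space S. ereal (C * a n) < \<bar>Z n \<omega>\<bar>} \<subseteq> A \<and> measure S A \<le> \<eta>)"

end

theory Submission
  imports Defs
begin

text \<open>
  Let \<open>D q v\<close> be the expected Dice ratio of the segmentation \<open>v\<close> when the labels are independent
  Bernoulli variables with success probabilities \<open>q\<close>. Conditional independence gives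
  \<open>Dice \<delta> = E (D (p X) (\<delta> X))\<close>, and ranking followed by volume selection maximizes \<open>D (q x)\<close> over all
  binary vectors. As \<open>D\<close> is 1-Lipschitz in every coordinate of \<open>q\<close>, the Dice regret of the plug-in rule
  is at most \<open>2 E (\<Sum>j. \<bar>p\<^sub>j X - q\<^sub>j X\<bar>)\<close>. The excess cross-entropy is the expected Kullback-Leibler
  divergence between \<open>p X\<close> and \<open>q X\<close>, which dominates \<open>E (\<Sum>j. (p\<^sub>j X - q\<^sub>j X)\<^sup>2) / 2\<close>, so that the
  Cauchy-Schwarz inequality finishes the proof.
\<close>

section \<open>Expectations under independent Bernoulli variables\<close>

declare sum_of_bool_eq [simp del]

text \<open>The law lives on a subset \<open>A\<close> of the coordinates, with the value
  \<open>False\<close> outside, so that coordinates can be split off one at a time.\<close>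

definition bernoulli_exp :: "'i set \<Rightarrow> ('i \<Rightarrow> real) \<Rightarrow> (('i \<Rightarrow> bool) \<Rightarrow> real) \<Rightarrow> real" where
  "bernoulli_exp A q \<phi> =
     measure_pmf.expectation (Pi_pmf A False (\<lambda>j. bernoulli_pmf (q j))) \<phi>"

lemma finite_set_Pi_bernoulli [simp]:
  assumes "finite A"
  shows "finite (set_pmf (Pi_pmf A False (\<lambda>j. bernoulli_pmf (q j))))"
  unfolding set_Pi_pmf[OF assms] using assms by (intro finite_PiE_dflt) auto

lemma integrable_Pi_bernoulli:
  fixes \<phi> :: "('i \<Rightarrow> bool) \<Rightarrow> real"
  assumes "finite A"
  shows "integrable (measure_pmf (Pi_pmf A False (\<lambda>j. bernoulli_pmf (q j)))) \<phi>"
  using assms by (intro integrable_measure_pmf_finite) simp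

text \<open>Conditioning on coordinate \<open>j\<close>, which is drawn independently of the others.
  The Lipschitz bound and the comparison of two pixels below rest on this recursion.\<close>

lemma bernoulli_exp_insert:
  assumes "finite A" "j \<notin> A" "0 \<le> q j" "q j \<le> 1"
  shows "bernoulli_exp (insert j A) q \<phi> =
    q j * bernoulli_exp A q (\<lambda>b. \<phi> (b(j := True))) +
    (1 - q j) * bernoulli_exp A q (\<lambda>b. \<phi> (b(j := False)))"
proof -
  have "Pi_pmf (insert j A) False (\<lambda>j. bernoulli_pmf (q j)) =
      bernoulli_pmf (q j) \<bind>
        (\<lambda>y. map_pmf (\<lambda>b. b(j := y)) (Pi_pmf A False (\<lambda>j. bernoulli_pmf (q j))))"
    using assms by (simp add: Pi_pmf_insert' map_pmf_def)
  moreover have "measure_pmf.expectation (bernoulli_pmf (q j) \<bind>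
        (\<lambda>y. map_pmf (\<lambda>b. b(j := y)) (Pi_pmf A False (\<lambda>j. bernoulli_pmf (q j))))) \<phi> =
      (\<Sum>y\<in>UNIV. pmf (bernoulli_pmf (q j)) y *\<^sub>R measure_pmf.expectation
        (map_pmf (\<lambda>b. b(j := y)) (Pi_pmf A False (\<lambda>j. bernoulli_pmf (q j)))) \<phi>)"
    using assms by (intro pmf_expectation_bind) simp_all
  ultimately show ?thesis
    unfolding bernoulli_exp_def using assms by (simp add: UNIV_bool)
qed

lemma bernoulli_exp_empty: "bernoulli_exp {} q \<phi> = \<phi> (\<lambda>_. False)"
  by (simp add: bernoulli_exp_def)

lemma bernoulli_exp_mono:
  assumes "finite A" "\<And>b. \<phi> b \<le> \<psi> b"
  shows "bernoulli_exp A q \<phi> \<le> bernoulli_exp A q \<psi>"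
  unfolding bernoulli_exp_def using assms
  by (intro integral_mono integrable_Pi_bernoulli) auto

lemma bernoulli_exp_add:
  assumes "finite A"
  shows "bernoulli_exp A q (\<lambda>b. \<phi> b + \<psi> b) = bernoulli_exp A q \<phi> + bernoulli_exp A q \<psi>"
  unfolding bernoulli_exp_def using assms
  by (intro Bochner_Integration.integral_add integrable_Pi_bernoulli)

lemma bernoulli_exp_sum:
  assumes "finite A"
  shows "bernoulli_exp A q (\<lambda>b. \<Sum>i\<in>I. \<phi> i b) = (\<Sum>i\<in>I. bernoulli_exp A q (\<phi> i))"
  unfolding bernoulli_exp_def using assms
  by (intro Bochner_Integration.integral_sum integrable_Pi_bernoulli)

lemma bernoulli_exp_const: "bernoulli_exp A q (\<lambda>_. c) = c"
  by (simp add: bernoulli_exp_def)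

text \<open>The laws are exchanged one coordinate at a time. With the others fixed, the expectation
  is affine in the probability of one coordinate, and its slope is a difference of two numbers in
  [0,1].\<close>

lemma bernoulli_exp_lipschitz:
  assumes "finite A"
    and "\<And>j. j \<in> A \<Longrightarrow> 0 \<le> p j \<and> p j \<le> 1" "\<And>j. j \<in> A \<Longrightarrow> 0 \<le> q j \<and> q j \<le> 1"
    and "\<And>b. 0 \<le> \<phi> b" "\<And>b. \<phi> b \<le> 1"
  shows "\<bar>bernoulli_exp A p \<phi> - bernoulli_exp A q \<phi>\<bar> \<le> (\<Sum>j\<in>A. \<bar>p j - q j\<bar>)"
  using assms
proof (induction A arbitrary: \<phi> rule: finite_induct)
  case empty
  then show ?case by (simp add: bernoulli_exp_empty)
next
  case (insert i A)
  define T F where "T = (\<lambda>b. \<phi> (b(i := True)))" and "F = (\<lambda>b. \<phi> (b(i := False)))"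
  define t t' f f' where "t = bernoulli_exp A p T" and "t' = bernoulli_exp A q T"
    and "f = bernoulli_exp A p F" and "f' = bernoulli_exp A q F"
  define D where "D = (\<Sum>j\<in>A. \<bar>p j - q j\<bar>)"
  have IH: "\<bar>t - t'\<bar> \<le> D" "\<bar>f - f'\<bar> \<le> D"
    unfolding t_def t'_def f_def f'_def D_def T_def F_def
    using insert.prems by (intro insert.IH; auto)+
  have "0 \<le> bernoulli_exp A r \<psi> \<and> bernoulli_exp A r \<psi> \<le> 1"
    if "\<And>b. 0 \<le> \<psi> b" "\<And>b. \<psi> b \<le> 1" for r :: "'a \<Rightarrow> real" and \<psi>
    using bernoulli_exp_mono[OF insert.hyps(1), of "\<lambda>_. 0" \<psi> r]
      bernoulli_exp_mono[OF insert.hyps(1), of \<psi> "\<lambda>_. 1" r] that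
    by (simp add: bernoulli_exp_const)
  then have b: "0 \<le> t'" "t' \<le> 1" "0 \<le> f'" "f' \<le> 1"
    unfolding t'_def f'_def T_def F_def using insert.prems by auto
  have pq: "0 \<le> p i" "p i \<le> 1" "0 \<le> q i" "q i \<le> 1" using insert.prems by auto
  \<comment> \<open>The first summand exchanges the laws on \<open>A\<close>, weighted by the law
    \<open>p\<close> of coordinate \<open>i\<close>; the second exchanges the law of
    \<open>i\<close> while \<open>q\<close> rules on \<open>A\<close>.\<close>
  have "bernoulli_exp (insert i A) p \<phi> - bernoulli_exp (insert i A) q \<phi> =
      (p i * (t - t') + (1 - p i) * (f - f')) + (p i - q i) * (t' - f')"
    using pq insert.hyps
    by (simp add: bernoulli_exp_insert t_def t'_def f_def f'_def T_def F_def algebra_simps)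
  also have "\<bar>\<dots>\<bar> \<le> \<bar>p i * (t - t') + (1 - p i) * (f - f')\<bar> + \<bar>(p i - q i) * (t' - f')\<bar>"
    by (rule abs_triangle_ineq)
  also have "\<bar>p i * (t - t') + (1 - p i) * (f - f')\<bar> \<le> p i * D + (1 - p i) * D"
  proof -
    have "\<bar>p i * (t - t') + (1 - p i) * (f - f')\<bar> \<le> p i * \<bar>t - t'\<bar> + (1 - p i) * \<bar>f - f'\<bar>"
      using abs_triangle_ineq[of "p i * (t - t')" "(1 - p i) * (f - f')"] pq by (simp add: abs_mult)
    also have "\<dots> \<le> p i * D + (1 - p i) * D"
      using pq IH by (intro add_mono mult_left_mono) auto
    finally show ?thesis .
  qed
  also have "\<bar>(p i - q i) * (t' - f')\<bar> \<le> \<bar>p i - q i\<bar>"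
    unfolding abs_mult using b by (intro mult_right_le_one_le) auto
  finally show ?case
    using insert.hyps by (simp add: D_def algebra_simps)
qed

section \<open>The expected Dice ratio of a plug-in rule\<close>

definition bvec :: "('d \<Rightarrow> bool) \<Rightarrow> real ^ 'd" where
  "bvec b = (\<chi> j. of_bool (b j))"

definition dice_ratio :: "real \<Rightarrow> real ^ 'd::finite \<Rightarrow> real ^ 'd \<Rightarrow> real" where
  "dice_ratio \<gamma> y v = (2 * (y \<bullet> v) + \<gamma>) / (norm1 y + norm1 v + \<gamma>)"

definition expected_dice :: "real \<Rightarrow> real ^ 'd::finite \<Rightarrow> real ^ 'd \<Rightarrow> real" where
  "expected_dice \<gamma> q v = bernoulli_exp UNIV (\<lambda>j. q $ j) (\<lambda>b. dice_ratio \<gamma> (bvec b) v)"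

text \<open>What a pixel \<open>j\<close> adds to the expected Dice ratio of any segmentation of
  size \<open>\<tau>\<close> containing it. The other selected pixels enter only through their
  number.\<close>

definition expected_hit :: "real \<Rightarrow> real ^ 'd::finite \<Rightarrow> nat \<Rightarrow> 'd \<Rightarrow> real" where
  "expected_hit \<gamma> q \<tau> j =
     bernoulli_exp UNIV (\<lambda>j. q $ j)
       (\<lambda>b. 2 * of_bool (b j) / (real (\<Sum>k\<in>UNIV. of_bool (b k)) + real \<tau> + \<gamma>))"

lemma binary_vecs_bvec: "v \<in> binary_vecs \<longleftrightarrow> (\<exists>b. v = bvec b)"
proof
  assume v: "v \<in> binary_vecs"
  show "\<exists>b. v = bvec b"
    by (intro exI[of _ "\<lambda>j. v $ j = 1"]) (use v in \<open>auto simp: binary_vecs_def bvec_def vec_eq_iff\<close>)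
qed (auto simp: binary_vecs_def bvec_def)

lemma bvec_in_binary_vecs [simp]: "bvec b \<in> binary_vecs"
  by (simp add: binary_vecs_def bvec_def)

text \<open>Fixing a split-off coordinate does not affect the count over the remaining ones. The
  rule \<open>sum_of_bool_eq\<close> would hide this by turning counts into cardinalities, hence its
  removal above.\<close>

lemma sum_of_bool_upd:
  "j \<notin> A \<Longrightarrow> (\<Sum>k\<in>A. of_bool ((b(j := x)) k)) = (\<Sum>k\<in>A. of_bool (b k))"
  by (intro sum.cong) auto

lemma norm1_bvec: "norm1 (bvec b) = real (\<Sum>k\<in>UNIV. of_bool (b k))"
  by (simp add: norm1_def bvec_def)

text \<open>The denominator depends on the segmentation only through its size. At a fixed size the
  expected ratio is thus a sum of separate contributions of the selected pixels, up to a common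
  term.\<close>

lemma expected_dice_bvec:
  fixes q :: "real ^ 'd::finite"
  shows "expected_dice \<gamma> q (bvec (\<lambda>j. j \<in> V)) =
    (\<Sum>j\<in>V. expected_hit \<gamma> q (card V) j) +
    bernoulli_exp UNIV (\<lambda>j. q $ j)
      (\<lambda>b. \<gamma> / (real (\<Sum>k\<in>UNIV. of_bool (b k)) + real (card V) + \<gamma>))"
proof -
  have "dice_ratio \<gamma> (bvec b) (bvec (\<lambda>j. j \<in> V)) =
      (\<Sum>j\<in>V. 2 * of_bool (b j) / (real (\<Sum>k\<in>UNIV. of_bool (b k)) + real (card V) + \<gamma>)) +
      \<gamma> / (real (\<Sum>k\<in>UNIV. of_bool (b k)) + real (card V) + \<gamma>)" for b :: "'d \<Rightarrow> bool"
  proof -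
    have "bvec b \<bullet> bvec (\<lambda>j. j \<in> V) = (\<Sum>j\<in>UNIV. if j \<in> V then of_bool (b j) else 0)"
      unfolding inner_vec_def by (intro sum.cong) (simp_all add: bvec_def)
    also have "\<dots> = (\<Sum>j\<in>V. of_bool (b j))"
      by (simp add: sum.inter_restrict[symmetric])
    finally have inner: "bvec b \<bullet> bvec (\<lambda>j. j \<in> V) = (\<Sum>j\<in>V. of_bool (b j))" .
    have "norm1 (bvec (\<lambda>j. j \<in> V)) = real (card V)"
      by (simp add: norm1_bvec sum_of_bool_eq del: of_nat_sum)
    then show ?thesis
      unfolding dice_ratio_def inner by (simp add: norm1_bvec add_divide_distrib sum_distrib_left
          sum_divide_distrib del: sum_of_bool_mult_eq sum_mult_of_bool_eq)
  qed
  then show ?thesis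
    unfolding expected_dice_def expected_hit_def
    by (simp add: bernoulli_exp_add bernoulli_exp_sum)
qed

text \<open>Only outcomes with \<open>b i \<noteq> b j\<close> contribute to the difference of the two sides.\<close>

lemma expected_hit_mono:
  fixes q :: "real ^ 'd::finite"
  assumes "0 \<le> \<gamma>" "\<And>j. 0 \<le> q $ j \<and> q $ j \<le> 1" "q $ i \<le> q $ j"
  shows "expected_hit \<gamma> q \<tau> i \<le> expected_hit \<gamma> q \<tau> j"
proof (cases "i = j")
  case False
  define A where "A = UNIV - {i, j}"
  \<comment> \<open>\<open>E\<close> belongs to outcomes where exactly one of the labels
    \<open>i\<close> and \<open>j\<close> is positive, \<open>E2\<close> to those where both are;
    hence the 1 and 2 added to the count over \<open>A\<close>.\<close>
  define E where "E = bernoulli_exp A (\<lambda>j. q $ j)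
      (\<lambda>b. 2 / (real (\<Sum>k\<in>A. of_bool (b k)) + 1 + real \<tau> + \<gamma>))"
  define E2 where "E2 = bernoulli_exp A (\<lambda>j. q $ j)
      (\<lambda>b. 2 / (real (\<Sum>k\<in>A. of_bool (b k)) + 2 + real \<tau> + \<gamma>))"
  have A: "i \<notin> A" "j \<notin> A" "finite A" "UNIV = insert i (insert j A)"
    by (auto simp: A_def)
  have q: "0 \<le> q $ i" "q $ i \<le> 1" "0 \<le> q $ j" "q $ j \<le> 1" using assms(2) by auto
  have "expected_hit \<gamma> q \<tau> i = q $ i * (q $ j * E2 + (1 - q $ j) * E)"
    unfolding expected_hit_def A(4) E_def E2_def using A(1-3) q False
    by (simp add: bernoulli_exp_insert bernoulli_exp_const sum_of_bool_upd del: fun_upd_apply)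
       (simp add: bernoulli_exp_const algebra_simps)
  moreover have "expected_hit \<gamma> q \<tau> j = q $ j * (q $ i * E2 + (1 - q $ i) * E)"
    unfolding expected_hit_def A(4) E_def E2_def using A(1-3) q False
    by (simp add: bernoulli_exp_insert bernoulli_exp_const sum_of_bool_upd del: fun_upd_apply)
       (simp add: bernoulli_exp_const algebra_simps)
  moreover have "0 \<le> E"
    unfolding E_def bernoulli_exp_def using assms(1)
    by (intro integral_nonneg_AE AE_I2) (auto intro!: divide_nonneg_nonneg add_nonneg_nonneg sum_nonneg)
  moreover have "q $ j * (q $ i * E2 + (1 - q $ i) * E) - q $ i * (q $ j * E2 + (1 - q $ j) * E)
      = (q $ j - q $ i) * E"
    by (simp add: algebra_simps)
  ultimately show ?thesis
    using assms(3) by (smt (verit) mult_nonneg_nonneg)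
qed simp

text \<open>Every upper limit \<open>m\<close> from \<open>card A\<close> on works, because the
  count never exceeds \<open>card A\<close>.\<close>

lemma sum_pmf_sum_bernoulli:
  fixes q :: "real ^ 'd::finite"
  assumes "card A \<le> m"
  shows "(\<Sum>l = 0..m. h l * pmf (sum_bernoulli A q) l) =
    bernoulli_exp A (\<lambda>j. q $ j) (\<lambda>b. h (\<Sum>k\<in>A. of_bool (b k)))"
proof -
  have "bernoulli_exp A (\<lambda>j. q $ j) (\<lambda>b. h (\<Sum>k\<in>A. of_bool (b k))) =
      measure_pmf.expectation (sum_bernoulli A q) h"
    by (simp add: bernoulli_exp_def sum_bernoulli_def)
  also have "\<dots> = (\<Sum>l\<in>{0..m}. pmf (sum_bernoulli A q) l *\<^sub>R h l)"
  proof (rule integral_measure_pmf)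
    fix l assume "l \<in> set_pmf (sum_bernoulli A q)"
    then obtain b :: "'d \<Rightarrow> bool" where "l = (\<Sum>k\<in>A. of_bool (b k))"
      by (auto simp: sum_bernoulli_def)
    also have "\<dots> \<le> (\<Sum>k\<in>A. 1)" by (intro sum_mono) auto
    finally show "l \<in> {0..m}" using assms by simp
  qed simp
  finally show ?thesis by (simp add: mult.commute)
qed

text \<open>Outcomes with label \<open>j\<close> equal to 0 contribute nothing. In the others the
  count is one more than over the remaining pixels, whence the \<open>+ 1\<close> in the
  denominator.\<close>

lemma expected_hit_eq:
  fixes q :: "real ^ 'd::finite"
  assumes "0 \<le> q $ j" "q $ j \<le> 1"
  shows "expected_hit \<gamma> q \<tau> j = (\<Sum>l = 0..CARD('d) - 1.
     2 / (real \<tau> + real l + \<gamma> + 1) * q $ j * pmf (sum_bernoulli (UNIV - {j}) q) l)"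
proof -
  define A where "A = UNIV - {j}"
  have A: "j \<notin> A" "finite A" "UNIV = insert j A" "card A \<le> CARD('d) - 1"
    by (auto simp: A_def)
  have "expected_hit \<gamma> q \<tau> j = q $ j * bernoulli_exp A (\<lambda>j. q $ j)
      (\<lambda>b. 2 / (real \<tau> + real (\<Sum>k\<in>A. of_bool (b k)) + \<gamma> + 1))"
    unfolding expected_hit_def A(3) using A(1,2) assms
    by (simp add: bernoulli_exp_insert bernoulli_exp_const sum_of_bool_upd del: fun_upd_apply)
       (simp add: bernoulli_exp_const algebra_simps)
  also have "\<dots> = q $ j * (\<Sum>l = 0..CARD('d) - 1.
      2 / (real \<tau> + real l + \<gamma> + 1) * pmf (sum_bernoulli A q) l)"
    by (simp only: sum_pmf_sum_bernoulli[OF A(4)])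
  finally show ?thesis by (simp add: A_def sum_distrib_left mult_ac)
qed

text \<open>Links the formula optimized in the volume step to the Dice ratio. A ranking is
  injective, so the first \<open>\<tau>\<close> ranks select exactly \<open>\<tau>\<close>
  pixels.\<close>

lemma volume_objective_eq:
  fixes q :: "real ^ 'd::finite"
  assumes "\<And>j. 0 \<le> q $ j \<and> q $ j \<le> 1" "ranking q r" "\<tau> \<le> CARD('d)"
  shows "volume_objective \<gamma> q r \<tau> = expected_dice \<gamma> q (bvec (\<lambda>j. j \<in> r ` {1..\<tau>}))"
proof -
  have inj: "inj_on r {1..\<tau>}"
    using assms by (auto simp: ranking_def bij_betw_def intro: inj_on_subset)
  then have card: "card (r ` {1..\<tau>}) = \<tau>" by (simp add: card_image)
  have "(\<Sum>l = 0..CARD('d). \<gamma> / (real \<tau> + real l + \<gamma>) * pmf (sum_bernoulli UNIV q) l) =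
    bernoulli_exp UNIV (\<lambda>j. q $ j) (\<lambda>b. \<gamma> / (real \<tau> + real (\<Sum>k\<in>UNIV. of_bool (b k)) + \<gamma>))"
    by (rule sum_pmf_sum_bernoulli) simp
  moreover have "(\<Sum>j\<in>r ` {1..\<tau>}. expected_hit \<gamma> q \<tau> j) = (\<Sum>s = 1..\<tau>. expected_hit \<gamma> q \<tau> (r s))"
    by (simp only: sum.reindex[OF inj] o_def)
  ultimately show ?thesis
    unfolding expected_dice_bvec card volume_objective_def
    using assms(1) by (simp add: expected_hit_eq add.commute)
qed

text \<open>An exchange argument: \<open>V - T\<close> and \<open>T - V\<close> have the same size,
  and no value on the former exceeds a value on the latter.\<close>

lemma sum_le_sum_top:
  fixes a :: "'d::finite \<Rightarrow> real"
  assumes "card V = card T" "\<And>i j. i \<in> T \<Longrightarrow> j \<notin> T \<Longrightarrow> a j \<le> a i"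
  shows "sum a V \<le> sum a T"
proof -
  have eq: "card (V - T) = card (T - V)"
    using assms(1) by (metis card_Diff_subset_Int finite inf_commute)
  have "sum a (V - T) \<le> sum a (T - V)"
  proof (cases "V - T = {}")
    case True
    then have "T - V = {}" using eq by (metis card_eq_0_iff finite)
    then show ?thesis using True by (simp only: sum.empty order_refl)
  next
    case False
    \<comment> \<open>The maximum is attained outside \<open>T\<close>, so it separates the values
      on the two sets. It requires \<open>V - T\<close> to be nonempty.\<close>
    define m where "m = Max (a ` (V - T))"
    have "sum a (V - T) \<le> of_nat (card (V - T)) * m"
      by (rule sum_bounded_above) (simp add: m_def)
    also have "\<dots> \<le> sum a (T - V)"
      unfolding eq using False assms(2)
      by (intro sum_bounded_below) (auto simp: m_def)
    finally show ?thesis .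
  qed
  moreover have "sum a V = sum a (V - T) + sum a (V \<inter> T)" "sum a T = sum a (T - V) + sum a (V \<inter> T)"
    using sum.Int_Diff[of V a T] sum.Int_Diff[of T a V] by (simp_all add: Int_commute)
  ultimately show ?thesis by simp
qed

text \<open>Two maximizations in sequence: among segmentations of the size of \<open>v\<close> the
  top-ranked one is best, and among the top-ranked ones of all sizes the volume step picks the
  best.\<close>

lemma rankdice_rule_optimal:
  fixes q :: "real ^ 'd::finite \<Rightarrow> real ^ 'd"
  assumes "0 \<le> \<gamma>" "q \<in> candidates" "rankdice_rule \<gamma> q \<delta>" "v \<in> binary_vecs"
  shows "expected_dice \<gamma> (q x) v \<le> expected_dice \<gamma> (q x) (\<delta> x)"
proof -
  obtain r \<tau> where r: "ranking (q x) (r x)"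
    and \<tau>: "is_arg_max (volume_objective \<gamma> (q x) (r x)) (\<lambda>t. t \<in> {0..CARD('d)}) (\<tau> x)"
    and \<delta>: "\<delta> x = (\<chi> j. if j \<in> r x ` {1..\<tau> x} then 1 else 0)"
    using assms(3) unfolding rankdice_rule_def by blast
  have q: "0 \<le> q x $ j \<and> q x $ j \<le> 1" for j
    using assms(2) by (auto simp: candidates_def)
  have \<delta>': "\<delta> x = bvec (\<lambda>j. j \<in> r x ` {1..\<tau> x})"
    by (auto simp: \<delta> bvec_def vec_eq_iff)
  obtain c where "v = bvec c" using assms(4) by (auto simp: binary_vecs_bvec)
  define V where "V = {j. c j}"
  define t where "t = card V"
  define T where "T = r x ` {1..t}"
  have v: "v = bvec (\<lambda>j. j \<in> V)" by (simp add: V_def \<open>v = bvec c\<close>)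
  have t: "t \<le> CARD('d)" unfolding t_def by (simp add: card_mono)
  have bij: "bij_betw (r x) {1..CARD('d)} UNIV" using r by (simp add: ranking_def)
  then have "inj_on (r x) {1..t}"
    using t by (auto simp: bij_betw_def intro: inj_on_subset)
  then have card: "card T = t" by (simp add: T_def card_image)
  have "q x $ j \<le> q x $ i" if i: "i \<in> T" and j: "j \<notin> T" for i j
  proof -
    obtain s where s: "i = r x s" "1 \<le> s" "s \<le> t" using i by (auto simp: T_def)
    obtain s' where s': "j = r x s'" "s' \<in> {1..CARD('d)}"
      using bij by (metis bij_betw_imp_surj_on UNIV_I imageE)
    then have "t < s'" using j by (auto simp: T_def not_le[symmetric])
    then show ?thesis using r s s' by (auto simp: ranking_def)
  qed
  then have "(\<Sum>j\<in>V. expected_hit \<gamma> (q x) t j) \<le> (\<Sum>j\<in>T. expected_hit \<gamma> (q x) t j)"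
    using assms(1) q by (intro sum_le_sum_top expected_hit_mono) (auto simp: card t_def)
  then have "expected_dice \<gamma> (q x) v \<le> expected_dice \<gamma> (q x) (bvec (\<lambda>j. j \<in> T))"
    unfolding v expected_dice_bvec card by (simp add: t_def)
  also have "\<dots> = volume_objective \<gamma> (q x) (r x) t"
    unfolding T_def using volume_objective_eq[OF q r t] by simp
  also have "\<dots> \<le> volume_objective \<gamma> (q x) (r x) (\<tau> x)"
    using \<tau> t by (auto simp: is_arg_max_linorder)
  also have "\<dots> = expected_dice \<gamma> (q x) (\<delta> x)"
    unfolding \<delta>' using \<tau> by (intro volume_objective_eq q r) (auto simp: is_arg_max_linorder)
  finally show ?thesis .
qed

section \<open>Dependence of the expected Dice ratio on the probabilities\<close>

lemma dice_ratio_bounds: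
  assumes "0 \<le> \<gamma>" "y \<in> binary_vecs" "v \<in> binary_vecs"
  shows "0 \<le> dice_ratio \<gamma> y v" "dice_ratio \<gamma> y v \<le> 1"
proof -
  \<comment> \<open>For entries 0 and 1 the product is at most the mean, which puts the numerator
    below the denominator. If the denominator is 0, division yields 0, which respects both
    bounds.\<close>
  have *: "0 \<le> y $ j * v $ j" "2 * (y $ j * v $ j) \<le> \<bar>y $ j\<bar> + \<bar>v $ j\<bar>" for j
  proof -
    have "y $ j = 0 \<or> y $ j = 1" "v $ j = 0 \<or> v $ j = 1"
      using assms(2,3) by (auto simp: binary_vecs_def)
    then show "0 \<le> y $ j * v $ j" "2 * (y $ j * v $ j) \<le> \<bar>y $ j\<bar> + \<bar>v $ j\<bar>" by auto
  qed
  have "0 \<le> y \<bullet> v" using * by (auto simp: inner_vec_def intro!: sum_nonneg)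
  moreover have "2 * (y \<bullet> v) \<le> norm1 y + norm1 v"
    unfolding inner_vec_def norm1_def sum_distrib_left sum.distrib[symmetric]
    by (intro sum_mono) (use * in auto)
  ultimately show "0 \<le> dice_ratio \<gamma> y v" "dice_ratio \<gamma> y v \<le> 1"
    using assms(1) by (auto simp: dice_ratio_def divide_le_eq_1 intro!: divide_nonneg_nonneg)
qed

lemma expected_dice_lipschitz:
  fixes p q v :: "real ^ 'd::finite"
  assumes "0 \<le> \<gamma>" "\<And>j. 0 \<le> p $ j \<and> p $ j \<le> 1" "\<And>j. 0 \<le> q $ j \<and> q $ j \<le> 1" "v \<in> binary_vecs"
  shows "\<bar>expected_dice \<gamma> p v - expected_dice \<gamma> q v\<bar> \<le> (\<Sum>j\<in>UNIV. \<bar>p $ j - q $ j\<bar>)"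
  unfolding expected_dice_def using assms
  by (intro bernoulli_exp_lipschitz dice_ratio_bounds) (auto simp: binary_vecs_bvec)

text \<open>Exchanging \<open>p\<close> for \<open>q x\<close> costs one l1-distance at
  \<open>v\<close> and one at \<open>\<delta> x\<close>, and under \<open>q x\<close> the rule is
  optimal; hence the factor 2.\<close>

lemma expected_dice_regret:
  fixes q :: "real ^ 'd::finite \<Rightarrow> real ^ 'd"
  assumes "0 \<le> \<gamma>" "q \<in> candidates" "rankdice_rule \<gamma> q \<delta>" "\<delta> x \<in> binary_vecs" "v \<in> binary_vecs"
    and "\<And>j. 0 \<le> p $ j \<and> p $ j \<le> 1"
  shows "expected_dice \<gamma> p v - expected_dice \<gamma> p (\<delta> x) \<le> 2 * (\<Sum>j\<in>UNIV. \<bar>p $ j - q x $ j\<bar>)"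
proof -
  have q: "0 \<le> q x $ j \<and> q x $ j \<le> 1" for j
    using assms(2) by (auto simp: candidates_def)
  show ?thesis
    using expected_dice_lipschitz[OF assms(1,6) q assms(4)]
      expected_dice_lipschitz[OF assms(1,6) q assms(5)] rankdice_rule_optimal[OF assms(1-3,5), of x]
    by linarith
qed

section \<open>Cross-entropy and squared error\<close>

text \<open>With values in [0, \<infinity>], expectations are nonnegative integrals that always
  exist. Truncation at 0 by \<open>ennreal\<close> occurs only for arguments above 1.\<close>

definition neglog :: "real \<Rightarrow> ennreal" where
  "neglog t = (if 0 < t then ennreal (- ln t) else \<top>)"

text \<open>The cross-entropy of Bernoulli laws with parameters \<open>a\<close> and
  \<open>t\<close>. The product of 0 and \<open>\<top>\<close> is 0, in accordance with 0 log 0 =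
  0.\<close>

definition cross_entropy :: "real \<Rightarrow> real \<Rightarrow> ennreal" where
  "cross_entropy a t = ennreal a * neglog t + ennreal (1 - a) * neglog (1 - t)"

lemma neglog_measurable [measurable]: "neglog \<in> borel_measurable borel"
  unfolding neglog_def by measurable

lemma e2ennreal_uminus_elog: "e2ennreal (- elog t) = neglog t"
  by (simp add: elog_def neglog_def)

lemma elog_nonpos: "t \<le> 1 \<Longrightarrow> elog t \<le> 0"
  by (simp add: elog_def)

text \<open>With summands of one sign there is neither cancellation between infinities nor
  truncation by \<open>e2ennreal\<close>.\<close>

lemma e2ennreal_uminus_sum:
  fixes f :: "'i \<Rightarrow> ereal"
  assumes "\<And>j. j \<in> A \<Longrightarrow> f j \<le> 0"
  shows "e2ennreal (- (\<Sum>j\<in>A. f j)) = (\<Sum>j\<in>A. e2ennreal (- f j))"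
proof -
  have add: "e2ennreal (- (a + b)) = e2ennreal (- a) + e2ennreal (- b)" if "a \<le> 0" "b \<le> 0" for a b :: ereal
    using that by (cases a; cases b) (auto simp flip: ennreal_plus)
  show ?thesis
    using assms
  proof (induction A rule: infinite_finite_induct)
    case (insert j A)
    then have "(\<Sum>j\<in>A. f j) \<le> 0" by (intro sum_nonpos) auto
    then show ?case using insert by (simp add: add)
  qed simp_all
qed

lemma ce_loss_bvec:
  fixes q :: "real ^ 'd::finite"
  assumes "\<And>j. 0 \<le> q $ j \<and> q $ j \<le> 1"
  shows "e2ennreal (ce_loss (bvec b) q) =
    (\<Sum>j\<in>UNIV. if b j then neglog (q $ j) else neglog (1 - q $ j))"
proof -
  \<comment> \<open>The label selects one of the two logarithms. The other is multiplied by 0, which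
    gives 0 even if it is infinite.\<close>
  have "(ereal (bvec b $ j) * elog (q $ j) + ereal (1 - bvec b $ j) * elog (1 - q $ j)) =
      (if b j then elog (q $ j) else elog (1 - q $ j))" for j
    by (simp add: bvec_def zero_ereal_def[symmetric] one_ereal_def[symmetric])
  then show ?thesis
    unfolding ce_loss_def using assms
    by (subst e2ennreal_uminus_sum)
       (auto intro!: sum.cong elog_nonpos simp: e2ennreal_uminus_elog)
qed

text \<open>The entropy of one label is bounded, so the risk of \<open>p\<close> will be finite and
  can be cancelled. The crude bound 2 comes from - x ln x \<le> 1 - x, used for both
  outcomes.\<close>

lemma cross_entropy_finite:
  assumes "0 \<le> a" "a \<le> 1"
  shows "cross_entropy a a = ennreal (- (a * ln a) - (1 - a) * ln (1 - a))"
    and "0 \<le> - (a * ln a) - (1 - a) * ln (1 - a)"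
    and "- (a * ln a) - (1 - a) * ln (1 - a) \<le> 2"
proof -
  have *: "0 \<le> - (x * ln x)" "- (x * ln x) \<le> 1" if "0 \<le> x" "x \<le> 1" for x :: real
  proof -
    show "0 \<le> - (x * ln x)" using that by (cases "x = 0") (auto simp: mult_le_0_iff)
    show "- (x * ln x) \<le> 1"
    proof (cases "x = 0")
      case False
      have "ln (1 / x) \<le> 1 / x - 1" using that False by (intro ln_le_minus_one) auto
      then have "x * ln (1 / x) \<le> x * (1 / x - 1)" using that by (intro mult_left_mono) auto
      then show ?thesis using that False by (simp add: ln_div algebra_simps)
    qed simp
  qed
  have eq: "ennreal x * neglog x = ennreal (- (x * ln x))" if "0 \<le> x" "x \<le> 1" for x :: real
    using that by (cases "x = 0") (auto simp: neglog_def ennreal_mult'[symmetric])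
  show "cross_entropy a a = ennreal (- (a * ln a) - (1 - a) * ln (1 - a))"
    using *[of a] *[of "1 - a"] assms
    by (simp add: cross_entropy_def eq ennreal_plus[symmetric] del: ennreal_plus)
  show "0 \<le> - (a * ln a) - (1 - a) * ln (1 - a)" "- (a * ln a) - (1 - a) * ln (1 - a) \<le> 2"
    using *[of a] *[of "1 - a"] assms by linarith+
qed

text \<open>The share of one outcome in the divergence. Over both outcomes the right-hand sides add
  up to the squared Hellinger distance that appears in \<open>hellinger_ge\<close>.\<close>

lemma neg_ln_ge_sqrt:
  assumes "0 \<le> a" "0 < (t::real)"
  shows "a * ln a + a * (- ln t) \<ge> 2 * (a - sqrt (a * t))"
proof (cases "a = 0")
  case False
  then have a: "0 < a" using assms by simp
  have "ln (sqrt (t / a)) \<le> sqrt (t / a) - 1"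
    using a assms by (intro ln_le_minus_one) auto
  then have "a * ((ln t - ln a) / 2) \<le> a * (sqrt (t / a) - 1)"
    using a assms by (intro mult_left_mono) (auto simp: ln_sqrt ln_div)
  moreover have "a * sqrt (t / a) = sqrt (a * t)"
    using a by (simp add: real_sqrt_divide real_sqrt_mult field_simps)
  ultimately show ?thesis by (simp add: algebra_simps add_divide_distrib diff_divide_distrib)
qed simp

text \<open>A difference of numbers in [0,1] is the difference of their roots times the sum of their
  roots, which is at most 2. Each of the two outcomes thus contributes at least
  \<open>(a - t)\<^sup>2 / 4\<close>.\<close>

lemma hellinger_ge:
  assumes "0 \<le> a" "a \<le> 1" "0 \<le> t" "t \<le> (1::real)"
  shows "2 * (1 - sqrt (a * t) - sqrt ((1 - a) * (1 - t))) \<ge> (a - t)\<^sup>2 / 2"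
proof -
  have *: "(x - y)\<^sup>2 \<le> 4 * (sqrt x - sqrt y)\<^sup>2" if "0 \<le> x" "x \<le> 1" "0 \<le> y" "y \<le> 1" for x y :: real
  proof -
    have "x - y = (sqrt x + sqrt y) * (sqrt x - sqrt y)"
      using that by (simp add: algebra_simps)
    then have "(x - y)\<^sup>2 = (sqrt x + sqrt y)\<^sup>2 * (sqrt x - sqrt y)\<^sup>2"
      by (simp add: power_mult_distrib)
    also have "\<dots> \<le> 2\<^sup>2 * (sqrt x - sqrt y)\<^sup>2"
    proof (intro mult_right_mono power_mono)
      have "sqrt x \<le> 1" "sqrt y \<le> 1" using that by auto
      then show "sqrt x + sqrt y \<le> 2" by linarith
    qed (use that in auto)
    finally show ?thesis by simp
  qed
  have "(sqrt a - sqrt t)\<^sup>2 + (sqrt (1 - a) - sqrt (1 - t))\<^sup>2 =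
      2 * (1 - sqrt (a * t) - sqrt ((1 - a) * (1 - t)))"
    using assms by (simp add: power2_diff real_sqrt_mult)
  moreover have "((1 - a) - (1 - t))\<^sup>2 = (a - t)\<^sup>2" by (simp add: power2_commute)
  ultimately show ?thesis
    using *[of a t] *[of "1 - a" "1 - t"] assms by simp
qed

text \<open>
  The bound \<open>ln x \<le> x - 1\<close> at \<open>x = sqrt (t / a)\<close> compares the divergence with the squared Hellinger
  distance; unlike Pinsker's inequality this needs no calculus, and costs only a constant.
\<close>

lemma cross_entropy_ge:
  assumes "0 \<le> a" "a \<le> 1" "0 \<le> t" "t \<le> 1"
  shows "cross_entropy a a + ennreal ((a - t)\<^sup>2 / 2) \<le> cross_entropy a t"
proof -
  \<comment> \<open>At the ends of the range, either \<open>t\<close> excludes an outcome that has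
    positive probability under \<open>a\<close>, and the right-hand side is infinite, or
    \<open>a = t\<close>.\<close>
  consider "t = 0" "a = 0" | "t = 0" "a > 0" | "t = 1" "a = 1" | "t = 1" "a < 1" | "0 < t" "t < 1"
    using assms by linarith
  then show ?thesis
  proof cases
    case 5
    define h where "h = - (a * ln a) - (1 - a) * ln (1 - a)"
    have h: "0 \<le> h" and ca: "cross_entropy a a = ennreal h"
      unfolding h_def using cross_entropy_finite assms by auto
    have "h + (a - t)\<^sup>2 / 2 \<le> a * (- ln t) + (1 - a) * (- ln (1 - t))"
      using neg_ln_ge_sqrt[OF assms(1) 5(1)] neg_ln_ge_sqrt[of "1 - a" "1 - t"] hellinger_ge[OF assms]
        5(2) assms(2)
      unfolding h_def by simp
    also have "ennreal \<dots> = cross_entropy a t"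
      using 5 assms
      by (simp add: cross_entropy_def neglog_def ennreal_mult'[symmetric] mult_nonneg_nonpos
          ennreal_plus[symmetric] del: ennreal_plus)
    finally show ?thesis
      using h by (simp add: ca ennreal_plus[symmetric] ennreal_leI del: ennreal_plus)
  qed (auto simp: cross_entropy_def neglog_def ennreal_mult_top)
qed

section \<open>The segmentation model\<close>

lemma borel_measurable_vec:
  fixes f :: "'a \<Rightarrow> real ^ 'd::finite"
  assumes "\<And>j. (\<lambda>x. f x $ j) \<in> borel_measurable M"
  shows "f \<in> borel_measurable M"
proof (rule borel_measurable_euclidean_space[THEN iffD2, OF ballI])
  fix i :: "real ^ 'd"
  assume "i \<in> Basis"
  then obtain j where "i = axis j 1" by (auto simp: Basis_vec_def)
  then show "(\<lambda>x. f x \<bullet> i) \<in> borel_measurable M" by (simp add: inner_axis assms)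
qed

lemma vec_nth_measurable [measurable (raw)]:
  fixes f :: "'a \<Rightarrow> real ^ 'd::finite"
  assumes "f \<in> borel_measurable M"
  shows "(\<lambda>x. f x $ j) \<in> borel_measurable M"
  by (rule borel_measurable_continuous_on[OF _ assms]) (intro continuous_intros)

lemma dice_ratio_measurable [measurable (raw)]:
  fixes f g :: "'a \<Rightarrow> real ^ 'd::finite"
  assumes [measurable]: "f \<in> borel_measurable M" "g \<in> borel_measurable M"
  shows "(\<lambda>x. dice_ratio \<gamma> (f x) (g x)) \<in> borel_measurable M"
  unfolding dice_ratio_def norm1_def by measurable

text \<open>Makes the plug-in rule a competitor in the maximization that defines the Bayes
  rule.\<close>

lemma rankdice_rule_seg_rules:
  fixes \<delta> :: "real ^ 'd::finite \<Rightarrow> real ^ 'd"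
  assumes "rankdice_rule \<gamma> q \<delta>"
  shows "\<delta> \<in> seg_rules"
proof -
  obtain r \<tau> where
    r [measurable]: "\<And>s. s \<in> {1..CARD('d)} \<Longrightarrow> (\<lambda>x. r x s) \<in> measurable borel (count_space UNIV)"
    and \<tau> [measurable]: "\<tau> \<in> measurable borel (count_space UNIV)"
    and max: "\<And>x. is_arg_max (volume_objective \<gamma> (q x) (r x)) (\<lambda>t. t \<in> {0..CARD('d)}) (\<tau> x)"
    and \<delta>: "\<delta> = (\<lambda>x. \<chi> j. if j \<in> r x ` {1..\<tau> x} then 1 else 0)"
    using assms unfolding rankdice_rule_def by blast
  have "\<tau> x \<le> CARD('d)" for x using max[of x] by (auto simp: is_arg_max_def)
  \<comment> \<open>The volume is at most the dimension, so the selection of \<open>j\<close> is a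
    finite union of events, over ranks at which \<open>r\<close> is measurable.\<close>
  then have eq: "j \<in> r x ` {1..\<tau> x} \<longleftrightarrow> (\<exists>s\<in>{1..CARD('d)}. s \<le> \<tau> x \<and> r x s = j)" for x j
    by (fastforce intro: order_trans)
  have "\<delta> \<in> borel_measurable borel"
  proof (rule borel_measurable_vec)
    fix j
    have "{x. \<exists>s\<in>{1..CARD('d)}. s \<le> \<tau> x \<and> r x s = j} =
        (\<Union>s\<in>{1..CARD('d)}. (\<tau> -` {s..} \<inter> space borel) \<inter> ((\<lambda>x. r x s) -` {j} \<inter> space borel))"
      by auto
    also have "\<dots> \<in> sets borel"
      by (intro sets.finite_UN sets.Int measurable_sets[OF \<tau>] measurable_sets[OF r]) auto
    finally show "(\<lambda>x. \<delta> x $ j) \<in> borel_measurable borel"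
      unfolding \<delta> eq by (auto intro!: measurable_If simp: pred_def)
  qed
  then show ?thesis by (auto simp: seg_rules_def \<delta> binary_vecs_def)
qed

lemma bernoulli_exp_UNIV:
  fixes q :: "'d::finite \<Rightarrow> real"
  shows "bernoulli_exp UNIV q \<phi> = (\<Sum>b\<in>UNIV. (\<Prod>j\<in>UNIV. pmf (bernoulli_pmf (q j)) (b j)) * \<phi> b)"
  unfolding bernoulli_exp_def
  by (subst integral_measure_pmf[of UNIV]) (simp_all add: pmf_Pi)

text \<open>\<open>bernoulli_pmf\<close> truncates its parameter to [0,1], so the whole line is
  covered. This matters because \<open>p (X \<omega>)\<close> has entries in [0,1] only almost
  surely.\<close>

lemma pmf_bernoulli_measurable [measurable]: "(\<lambda>x. pmf (bernoulli_pmf x) c) \<in> borel_measurable borel"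
  by (cases c) (simp_all add: bernoulli_pmf.rep_eq)

locale segmentation_model = prob_space M for M :: "'a measure" +
  fixes X Y :: "'a \<Rightarrow> real ^ 'd::finite" and p :: "real ^ 'd \<Rightarrow> real ^ 'd"
  assumes X [measurable]: "X \<in> borel_measurable M"
    and Y [measurable]: "Y \<in> borel_measurable M"
    and Y_binary: "\<And>\<omega>. \<omega> \<in> space M \<Longrightarrow> Y \<omega> \<in> binary_vecs"
    and cond_indep: "cond_indep_vars M (gen_sigma M X) (\<lambda>j. borel) (\<lambda>j \<omega>. Y \<omega> $ j) UNIV"
    and cond_prob: "cond_prob_version M X Y p"
begin

section \<open>Conditional law of the labels given the features\<close>

lemma p_measurable [measurable]: "p \<in> borel_measurable borel"
  using cond_prob by (simp add: cond_prob_version_def)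

lemma X_gen_sigma: "X \<in> borel_measurable (gen_sigma M X)"
  unfolding gen_sigma_def by (intro measurable_vimage_algebra1) auto

sublocale finite_measure_subalgebra M "gen_sigma M X"
proof
  show "subalgebra M (gen_sigma M X)"
    unfolding subalgebra_def gen_sigma_def
    by (auto simp: sets_vimage_algebra2 intro: measurable_sets[OF X])
qed

lemma fun_of_X_gen_sigma:
  "g \<in> measurable borel N \<Longrightarrow> (\<lambda>\<omega>. g (X \<omega>)) \<in> measurable (gen_sigma M X) N"
  by (rule measurable_compose[OF X_gen_sigma])

text \<open>Here \<open>g\<close> may be infinite, as the logarithmic loss requires;
  \<open>integral_prob_given\<close> treats the bounded integrands that come from Dice.\<close>

lemma nn_integral_prob_given:
  fixes g :: "real ^ 'd \<Rightarrow> ennreal"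
  assumes [measurable]: "B \<in> sets M" "g \<in> borel_measurable borel"
  shows "(\<integral>\<^sup>+\<omega>. g (X \<omega>) * indicator B \<omega> \<partial>M) =
    (\<integral>\<^sup>+\<omega>. g (X \<omega>) * ennreal (prob_given M (gen_sigma M X) B \<omega>) \<partial>M)"
proof -
  let ?F = "gen_sigma M X"
  \<comment> \<open>\<open>real_cond_exp\<close> is a difference of two nonnegative conditional
    expectations turned into reals. For an indicator the second is 0 and the first at most 1, so the
    conversion loses nothing.\<close>
  have "AE \<omega> in M. nn_cond_exp M ?F (indicator B) \<omega> \<le> nn_cond_exp M ?F (\<lambda>_. 1) \<omega>"
    by (intro nn_cond_exp_mono) (auto simp: indicator_def)
  moreover have "AE \<omega> in M. 1 = nn_cond_exp M ?F (\<lambda>_. 1) \<omega>"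
    by (rule nn_cond_exp_F_meas) simp
  moreover have "AE \<omega> in M. 0 = nn_cond_exp M ?F (\<lambda>_. 0) \<omega>"
    by (rule nn_cond_exp_F_meas) simp
  ultimately have "AE \<omega> in M. ennreal (prob_given M ?F B \<omega>) = nn_cond_exp M ?F (indicator B) \<omega>"
  proof eventually_elim
    case (elim \<omega>)
    have "(\<lambda>x. ennreal (- indicator B x)) = (\<lambda>_. 0 :: ennreal)" "(\<lambda>x. ennreal (indicator B x)) = indicator B"
      by (auto simp: fun_eq_iff indicator_def ennreal_neg)
    moreover have "nn_cond_exp M ?F (indicator B) \<omega> < \<top>"
      using elim by (metis ennreal_one_less_top order_le_less_trans)
    ultimately show ?case
      using elim(3) unfolding prob_given_def real_cond_exp_def by simp
  qed
  then have "(\<integral>\<^sup>+\<omega>. g (X \<omega>) * ennreal (prob_given M ?F B \<omega>) \<partial>M) =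
      (\<integral>\<^sup>+\<omega>. g (X \<omega>) * nn_cond_exp M ?F (indicator B) \<omega> \<partial>M)"
    by (intro nn_integral_cong_AE) auto
  also have "\<dots> = (\<integral>\<^sup>+\<omega>. g (X \<omega>) * indicator B \<omega> \<partial>M)"
    by (intro nn_cond_exp_intg fun_of_X_gen_sigma) auto
  finally show ?thesis ..
qed

lemma integral_prob_given:
  fixes g :: "real ^ 'd \<Rightarrow> real"
  assumes [measurable]: "B \<in> sets M" "g \<in> borel_measurable borel" and "\<And>x. \<bar>g x\<bar> \<le> c"
  shows "integrable M (\<lambda>\<omega>. g (X \<omega>) * prob_given M (gen_sigma M X) B \<omega>)"
    and "integrable M (\<lambda>\<omega>. g (X \<omega>) * indicator B \<omega>)"
    and "(\<integral>\<omega>. g (X \<omega>) * prob_given M (gen_sigma M X) B \<omega> \<partial>M) = (\<integral>\<omega>. g (X \<omega>) * indicator B \<omega> \<partial>M)"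
proof -
  have "0 \<le> c" using assms(3)[of 0] by linarith
  show int: "integrable M (\<lambda>\<omega>. g (X \<omega>) * indicator B \<omega>)"
    using assms(3) \<open>0 \<le> c\<close> by (intro integrable_const_bound[of _ c]) (auto simp: indicator_def)
  show "integrable M (\<lambda>\<omega>. g (X \<omega>) * prob_given M (gen_sigma M X) B \<omega>)"
    "(\<integral>\<omega>. g (X \<omega>) * prob_given M (gen_sigma M X) B \<omega> \<partial>M) = (\<integral>\<omega>. g (X \<omega>) * indicator B \<omega> \<partial>M)"
    unfolding prob_given_def using int
    by (intro real_cond_exp_intg fun_of_X_gen_sigma; simp)+
qed

text \<open>The conditional probabilities of the labels 0 and 1 are nonnegative and add up to 1.
  This also places \<open>p (X \<omega>)\<close> in the unit cube almost surely, which
  \<open>cond_prob_version\<close> does not state.\<close>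

lemma AE_prob_given_bit:
  "AE \<omega> in M. \<forall>j. 0 \<le> p (X \<omega>) $ j \<and> p (X \<omega>) $ j \<le> 1 \<and>
     (\<forall>c. prob_given M (gen_sigma M X) {w \<in> space M. Y w $ j = of_bool c} \<omega> =
       pmf (bernoulli_pmf (p (X \<omega>) $ j)) c)"
  unfolding AE_all_countable
proof (intro allI)
  fix j
  let ?F = "gen_sigma M X"
  let ?B = "\<lambda>c. {w \<in> space M. Y w $ j = of_bool c}"
  have [measurable]: "?B c \<in> sets M" for c by measurable
  have int: "integrable M (indicator (?B c) :: 'a \<Rightarrow> real)" for c
    by (intro integrable_const_bound[of _ 1]) (auto simp: indicator_def)
  have pos: "AE \<omega> in M. 0 \<le> prob_given M ?F (?B c) \<omega>" for c
    unfolding prob_given_def by (intro real_cond_exp_pos) auto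
  have "AE \<omega> in M. real_cond_exp M ?F (\<lambda>w. indicator (?B True) w + indicator (?B False) w) \<omega> =
      prob_given M ?F (?B True) \<omega> + prob_given M ?F (?B False) \<omega>"
    unfolding prob_given_def by (intro real_cond_exp_add int)
  moreover have "AE \<omega> in M. real_cond_exp M ?F (\<lambda>w. indicator (?B True) w + indicator (?B False) w) \<omega> =
      real_cond_exp M ?F (\<lambda>_. 1) \<omega>"
  proof (intro real_cond_exp_cong AE_I2)
    fix w assume "w \<in> space M"
    then show "indicator (?B True) w + indicator (?B False) w = (1 :: real)"
      using Y_binary[of w] by (auto simp: indicator_def binary_vecs_def)
  qed auto
  moreover have "AE \<omega> in M. real_cond_exp M ?F (\<lambda>_. 1) \<omega> = 1"
    by (rule real_cond_exp_F_meas) auto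
  moreover have "AE \<omega> in M. p (X \<omega>) $ j = prob_given M ?F {w \<in> space M. Y w $ j = 1} \<omega>"
    using cond_prob by (simp add: cond_prob_version_def)
  ultimately show "AE \<omega> in M. 0 \<le> p (X \<omega>) $ j \<and> p (X \<omega>) $ j \<le> 1 \<and>
     (\<forall>c. prob_given M ?F (?B c) \<omega> = pmf (bernoulli_pmf (p (X \<omega>) $ j)) c)"
    using pos[of True] pos[of False]
  proof eventually_elim
    case (elim \<omega>)
    then have "0 \<le> p (X \<omega>) $ j" "p (X \<omega>) $ j \<le> 1"
      "prob_given M ?F (?B True) \<omega> = p (X \<omega>) $ j" "prob_given M ?F (?B False) \<omega> = 1 - p (X \<omega>) $ j"
      by simp_all
    then show ?case by (simp add: all_bool_eq)
  qed
qed

text \<open>Conditional independence for singletons: given the features, \<open>Y\<close> follows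
  the product law of \<open>expected_dice\<close>.\<close>

lemma AE_prob_given_vec:
  "AE \<omega> in M. prob_given M (gen_sigma M X) {w \<in> space M. Y w = bvec b} \<omega> =
     (\<Prod>j\<in>UNIV. pmf (bernoulli_pmf (p (X \<omega>) $ j)) (b j))"
proof -
  have eq: "{w \<in> space M. \<forall>j\<in>UNIV. Y w $ j \<in> {of_bool (b j)}} = {w \<in> space M. Y w = bvec b}"
    by (auto simp: bvec_def vec_eq_iff)
  have "AE \<omega> in M. prob_given M (gen_sigma M X) {w \<in> space M. \<forall>j\<in>UNIV. Y w $ j \<in> {of_bool (b j)}} \<omega> =
      (\<Prod>j\<in>UNIV. prob_given M (gen_sigma M X) {w \<in> space M. Y w $ j \<in> {of_bool (b j)}} \<omega>)"
    using cond_indep unfolding cond_indep_vars_def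
    by (elim conjE allE[of _ UNIV] impE ballE[of _ _ "\<lambda>j. {of_bool (b j)}"]) auto
  then show ?thesis
    unfolding eq using AE_prob_given_bit by eventually_elim simp
qed

text \<open>\<open>Y\<close> takes finitely many values, so the integrand splits into functions of
  \<open>X\<close> times indicators of these values, and each indicator may be replaced by its
  conditional probability.\<close>

lemma Dice_eq:
  assumes "0 \<le> \<gamma>" "\<delta> \<in> seg_rules"
  shows "integrable M (\<lambda>\<omega>. expected_dice \<gamma> (p (X \<omega>)) (\<delta> (X \<omega>)))"
    and "Dice \<gamma> M X Y \<delta> = (\<integral>\<omega>. expected_dice \<gamma> (p (X \<omega>)) (\<delta> (X \<omega>)) \<partial>M)"
proof -
  let ?B = "\<lambda>b. {w \<in> space M. Y w = bvec b}"
  define g where "g = (\<lambda>b x. dice_ratio \<gamma> (bvec b) (\<delta> x))"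
  have \<delta> [measurable]: "\<delta> \<in> borel_measurable borel" and \<delta>b: "\<And>x. \<delta> x \<in> binary_vecs"
    using assms(2) by (auto simp: seg_rules_def)
  have B [measurable]: "?B b \<in> sets M" for b by measurable
  have g [measurable]: "g b \<in> borel_measurable borel" for b unfolding g_def by measurable
  have g1: "\<bar>g b x\<bar> \<le> 1" for b x
    using dice_ratio_bounds[OF assms(1) _ \<delta>b[of x], of "bvec b"] by (auto simp: g_def)
  note i = integral_prob_given[OF B g g1]
  have eq: "AE \<omega> in M. expected_dice \<gamma> (p (X \<omega>)) (\<delta> (X \<omega>)) =
      (\<Sum>b\<in>UNIV. g b (X \<omega>) * prob_given M (gen_sigma M X) (?B b) \<omega>)"
  proof -
    have "AE \<omega> in M. \<forall>b. prob_given M (gen_sigma M X) (?B b) \<omega> =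
       (\<Prod>j\<in>UNIV. pmf (bernoulli_pmf (p (X \<omega>) $ j)) (b j))"
      unfolding AE_all_countable using AE_prob_given_vec by blast
    then show ?thesis
      by eventually_elim (simp add: expected_dice_def bernoulli_exp_UNIV g_def mult.commute)
  qed
  have meas [measurable]: "(\<lambda>\<omega>. expected_dice \<gamma> (p (X \<omega>)) (\<delta> (X \<omega>))) \<in> borel_measurable M"
    unfolding expected_dice_def bernoulli_exp_UNIV by measurable
  show "integrable M (\<lambda>\<omega>. expected_dice \<gamma> (p (X \<omega>)) (\<delta> (X \<omega>)))"
    by (rule integrable_cong_AE_imp[OF Bochner_Integration.integrable_sum[OF i(1)] meas AE_symmetric[OF eq]])
  have "(\<integral>\<omega>. expected_dice \<gamma> (p (X \<omega>)) (\<delta> (X \<omega>)) \<partial>M) =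
      (\<integral>\<omega>. (\<Sum>b\<in>UNIV. g b (X \<omega>) * prob_given M (gen_sigma M X) (?B b) \<omega>) \<partial>M)"
    using eq i by (intro integral_cong_AE) auto
  also have "\<dots> = (\<Sum>b\<in>UNIV. \<integral>\<omega>. g b (X \<omega>) * indicator (?B b) \<omega> \<partial>M)"
    using i by (subst Bochner_Integration.integral_sum) auto
  also have "\<dots> = (\<integral>\<omega>. (\<Sum>b\<in>UNIV. g b (X \<omega>) * indicator (?B b) \<omega>) \<partial>M)"
    using i by (subst Bochner_Integration.integral_sum) auto
  also have "\<dots> = Dice \<gamma> M X Y \<delta>"
    unfolding Dice_def
  proof (rule Bochner_Integration.integral_cong)
    fix \<omega> assume \<omega>: "\<omega> \<in> space M"
    then obtain c where c: "Y \<omega> = bvec c" using Y_binary by (auto simp: binary_vecs_bvec)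
    have "bvec c = (bvec b :: real ^ 'd) \<longleftrightarrow> c = b" for b
      by (auto simp: bvec_def vec_eq_iff fun_eq_iff)
    then have "(\<Sum>b\<in>UNIV. g b (X \<omega>) * indicator (?B b) \<omega>) = (\<Sum>b\<in>UNIV. if b = c then g c (X \<omega>) else 0)"
      using \<omega> c by (intro sum.cong) (auto simp: indicator_def)
    then show "(\<Sum>b\<in>UNIV. g b (X \<omega>) * indicator (?B b) \<omega>) =
        (2 * (Y \<omega> \<bullet> \<delta> (X \<omega>)) + \<gamma>) / (norm1 (Y \<omega>) + norm1 (\<delta> (X \<omega>)) + \<gamma>)"
      by (simp add: g_def c dice_ratio_def)
  qed simp
  finally show "Dice \<gamma> M X Y \<delta> = (\<integral>\<omega>. expected_dice \<gamma> (p (X \<omega>)) (\<delta> (X \<omega>)) \<partial>M)" ..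
qed

text \<open>The loss is a sum over pixels, so the conditional laws of the single labels determine
  the risk. The bounds on \<open>q\<close> are required only almost surely because \<open>p\<close>
  is one of the applications.\<close>

lemma ce_risk_eq:
  assumes [measurable]: "q \<in> borel_measurable borel"
    and "AE \<omega> in M. \<forall>j. 0 \<le> q (X \<omega>) $ j \<and> q (X \<omega>) $ j \<le> 1"
  shows "ce_risk M X Y q =
    enn2ereal (\<integral>\<^sup>+\<omega>. (\<Sum>j\<in>UNIV. cross_entropy (p (X \<omega>) $ j) (q (X \<omega>) $ j)) \<partial>M)"
proof -
  let ?F = "gen_sigma M X"
  let ?B = "\<lambda>j c. {w \<in> space M. Y w $ j = of_bool c}"
  have [measurable]: "?B j c \<in> sets M" for j c by measurable
  have "AE \<omega> in M. e2ennreal (ce_loss (Y \<omega>) (q (X \<omega>))) =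
      (\<Sum>j\<in>UNIV. neglog (q (X \<omega>) $ j) * indicator (?B j True) \<omega> +
        neglog (1 - q (X \<omega>) $ j) * indicator (?B j False) \<omega>)"
    using assms(2) AE_space
  proof eventually_elim
    case (elim \<omega>)
    then obtain c where c: "Y \<omega> = bvec c" using Y_binary by (auto simp: binary_vecs_bvec)
    show ?case
      unfolding c using elim c
      by (subst ce_loss_bvec) (auto intro!: sum.cong simp: indicator_def bvec_def)
  qed
  then have "(\<integral>\<^sup>+\<omega>. e2ennreal (ce_loss (Y \<omega>) (q (X \<omega>))) \<partial>M) =
      (\<integral>\<^sup>+\<omega>. (\<Sum>j\<in>UNIV. neglog (q (X \<omega>) $ j) * indicator (?B j True) \<omega> +
        neglog (1 - q (X \<omega>) $ j) * indicator (?B j False) \<omega>) \<partial>M)"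
    by (rule nn_integral_cong_AE)
  also have "\<dots> = (\<Sum>j\<in>UNIV. (\<integral>\<^sup>+\<omega>. neglog (q (X \<omega>) $ j) * indicator (?B j True) \<omega> \<partial>M) +
        (\<integral>\<^sup>+\<omega>. neglog (1 - q (X \<omega>) $ j) * indicator (?B j False) \<omega> \<partial>M))"
    by (simp add: nn_integral_sum nn_integral_add)
  also have "\<dots> = (\<Sum>j\<in>UNIV.
        (\<integral>\<^sup>+\<omega>. neglog (q (X \<omega>) $ j) * ennreal (prob_given M ?F (?B j True) \<omega>) \<partial>M) +
        (\<integral>\<^sup>+\<omega>. neglog (1 - q (X \<omega>) $ j) * ennreal (prob_given M ?F (?B j False) \<omega>) \<partial>M))"
    by (intro sum.cong refl arg_cong2[where f = "(+)"]
        nn_integral_prob_given[where g = "\<lambda>x. neglog (q x $ _)"]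
        nn_integral_prob_given[where g = "\<lambda>x. neglog (1 - q x $ _)"]) auto
  also have "\<dots> = (\<Sum>j\<in>UNIV. (\<integral>\<^sup>+\<omega>. neglog (q (X \<omega>) $ j) * ennreal (p (X \<omega>) $ j) \<partial>M) +
        (\<integral>\<^sup>+\<omega>. neglog (1 - q (X \<omega>) $ j) * ennreal (1 - p (X \<omega>) $ j) \<partial>M))"
  proof (intro sum.cong refl arg_cong2[where f = "(+)"] nn_integral_cong_AE)
    fix j
    show "AE \<omega> in M. neglog (q (X \<omega>) $ j) * ennreal (prob_given M ?F (?B j True) \<omega>) =
        neglog (q (X \<omega>) $ j) * ennreal (p (X \<omega>) $ j)"
      using AE_prob_given_bit by eventually_elim (metis pmf_bernoulli_True)
    show "AE \<omega> in M. neglog (1 - q (X \<omega>) $ j) * ennreal (prob_given M ?F (?B j False) \<omega>) =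
        neglog (1 - q (X \<omega>) $ j) * ennreal (1 - p (X \<omega>) $ j)"
      using AE_prob_given_bit by eventually_elim (metis pmf_bernoulli_False)
  qed
  also have "\<dots> = (\<integral>\<^sup>+\<omega>. (\<Sum>j\<in>UNIV. cross_entropy (p (X \<omega>) $ j) (q (X \<omega>) $ j)) \<partial>M)"
    by (simp add: cross_entropy_def nn_integral_sum nn_integral_add mult.commute)
  finally show ?thesis unfolding ce_risk_def by simp
qed

text \<open>Integrates \<open>cross_entropy_ge\<close> over the features; the factor 2 undoes the
  division by 2 there.\<close>

lemma ce_excess_bound:
  assumes "q \<in> candidates" "ce_excess M X Y p q \<le> ereal K" "0 \<le> K"
  shows "integrable M (\<lambda>\<omega>. \<Sum>j\<in>UNIV. (p (X \<omega>) $ j - q (X \<omega>) $ j)\<^sup>2)"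
    and "(\<integral>\<omega>. (\<Sum>j\<in>UNIV. (p (X \<omega>) $ j - q (X \<omega>) $ j)\<^sup>2) \<partial>M) \<le> 2 * K"
proof -
  define S where "S = (\<lambda>\<omega>. \<Sum>j\<in>UNIV. (p (X \<omega>) $ j - q (X \<omega>) $ j)\<^sup>2)"
  have [measurable]: "q \<in> borel_measurable borel" and q: "\<And>x j. 0 \<le> q x $ j \<and> q x $ j \<le> 1"
    using assms(1) by (auto simp: candidates_def)
  have S_meas [measurable]: "S \<in> borel_measurable M" unfolding S_def by measurable
  have S0: "0 \<le> S \<omega>" for \<omega> unfolding S_def by (intro sum_nonneg) auto
  have p01: "AE \<omega> in M. \<forall>j. 0 \<le> p (X \<omega>) $ j \<and> p (X \<omega>) $ j \<le> 1"
    using AE_prob_given_bit by eventually_elim auto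
  let ?R = "\<lambda>r. \<integral>\<^sup>+\<omega>. (\<Sum>j\<in>UNIV. cross_entropy (p (X \<omega>) $ j) (r (X \<omega>) $ j)) \<partial>M"
  have CE_meas [measurable]: "(\<lambda>\<omega>. \<Sum>j\<in>UNIV. cross_entropy (p (X \<omega>) $ j) (p (X \<omega>) $ j)) \<in> borel_measurable M"
    unfolding cross_entropy_def by measurable
  \<comment> \<open>Each pixel contributes at most 2, so the risk of \<open>p\<close> is finite and
    can be cancelled from both sides later.\<close>
  have "?R p \<le> (\<integral>\<^sup>+\<omega>. (\<Sum>j\<in>(UNIV :: 'd set). 2) \<partial>M)"
    using p01
  proof (intro nn_integral_mono_AE, eventually_elim)
    case (elim \<omega>)
    have "cross_entropy (p (X \<omega>) $ j) (p (X \<omega>) $ j) \<le> ennreal 2" for j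
      unfolding cross_entropy_finite(1)[OF elim(2)[rule_format, THEN conjunct1] elim(2)[rule_format, THEN conjunct2]]
      using elim(2) by (intro ennreal_leI cross_entropy_finite(3)) auto
    then show ?case by (intro sum_mono) simp
  qed
  also have "\<dots> < \<top>" by (simp add: emeasure_space_1 ennreal_mult_less_top of_nat_less_top)
  finally have fin: "?R p < \<top>" .
  have "?R p + (\<integral>\<^sup>+\<omega>. ennreal (S \<omega> / 2) \<partial>M) =
      (\<integral>\<^sup>+\<omega>. (\<Sum>j\<in>UNIV. cross_entropy (p (X \<omega>) $ j) (p (X \<omega>) $ j)) + ennreal (S \<omega> / 2) \<partial>M)"
    by (subst nn_integral_add) auto
  also have "\<dots> \<le> ?R q"
    using p01
  proof (intro nn_integral_mono_AE, eventually_elim)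
    case (elim \<omega>)
    have "(\<Sum>j\<in>UNIV. cross_entropy (p (X \<omega>) $ j) (p (X \<omega>) $ j)) + ennreal (S \<omega> / 2) =
        (\<Sum>j\<in>UNIV. cross_entropy (p (X \<omega>) $ j) (p (X \<omega>) $ j) + ennreal ((p (X \<omega>) $ j - q (X \<omega>) $ j)\<^sup>2 / 2))"
      by (simp add: S_def sum.distrib sum_divide_distrib sum_ennreal)
    also have "\<dots> \<le> (\<Sum>j\<in>UNIV. cross_entropy (p (X \<omega>) $ j) (q (X \<omega>) $ j))"
      using elim(2) q by (intro sum_mono cross_entropy_ge) auto
    finally show ?case .
  qed
  finally have le: "?R p + (\<integral>\<^sup>+\<omega>. ennreal (S \<omega> / 2) \<partial>M) \<le> ?R q" .
  have "enn2ereal (?R q) - enn2ereal (?R p) \<le> ereal K"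
    using assms(2) p01 q unfolding ce_excess_def by (simp add: ce_risk_eq)
  \<comment> \<open>An infinite risk of \<open>q\<close> would make the excess infinite, against the
    bound \<open>K\<close>.\<close>
  then have "enn2ereal (?R q) \<le> enn2ereal (?R p) + ereal K"
    using fin by (cases "enn2ereal (?R q)"; cases "?R p") (auto simp: enn2ereal_ennreal)
  also have "\<dots> = enn2ereal (?R p + ennreal K)"
    using assms(3) by (simp add: plus_ennreal.rep_eq enn2ereal_ennreal)
  finally have "?R q \<le> ?R p + ennreal K" by (simp add: less_eq_ennreal.rep_eq)
  with le have "?R p + (\<integral>\<^sup>+\<omega>. ennreal (S \<omega> / 2) \<partial>M) \<le> ?R p + ennreal K" by (rule order_trans)
  then have nn: "(\<integral>\<^sup>+\<omega>. ennreal (S \<omega> / 2) \<partial>M) \<le> ennreal K"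
    using fin by (auto simp: ennreal_add_left_cancel_le)
  have int: "integrable M (\<lambda>\<omega>. S \<omega> / 2)"
    using S0 order_le_less_trans[OF nn ennreal_less_top] by (intro integrableI_nonneg) auto
  from integrable_mult_right[OF this, of 2]
  show "integrable M (\<lambda>\<omega>. \<Sum>j\<in>UNIV. (p (X \<omega>) $ j - q (X \<omega>) $ j)\<^sup>2)"
    by (simp add: S_def)
  have "(\<integral>\<omega>. S \<omega> / 2 \<partial>M) \<le> K"
    using nn S0 int assms(3) by (simp add: nn_integral_eq_integral ennreal_le_iff)
  then show "(\<integral>\<omega>. (\<Sum>j\<in>UNIV. (p (X \<omega>) $ j - q (X \<omega>) $ j)\<^sup>2) \<partial>M) \<le> 2 * K"
    by (simp add: S_def[symmetric])
qed

text \<open>The pointwise regret is integrated; the Cauchy-Schwarz inequality, over pixels and then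
  over the features, passes from absolute to squared errors.\<close>

lemma Dice_regret:
  assumes "0 \<le> \<gamma>" "q \<in> candidates" "rankdice_rule \<gamma> q \<delta>" "bayes_rule \<gamma> M X Y \<delta>s"
    and "ce_excess M X Y p q \<le> ereal K" "0 \<le> K"
  shows "\<bar>Dice \<gamma> M X Y \<delta>s - Dice \<gamma> M X Y \<delta>\<bar> \<le> 2 * sqrt (2 * real CARD('d) * K)"
proof -
  define Z where "Z = (\<lambda>\<omega>. \<Sum>j\<in>UNIV. \<bar>p (X \<omega>) $ j - q (X \<omega>) $ j\<bar>)"
  define S where "S = (\<lambda>\<omega>. \<Sum>j\<in>UNIV. (p (X \<omega>) $ j - q (X \<omega>) $ j)\<^sup>2)"
  have [measurable]: "q \<in> borel_measurable borel" using assms(2) by (simp add: candidates_def)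
  have [measurable]: "Z \<in> borel_measurable M" unfolding Z_def by measurable
  have S: "integrable M S" "(\<integral>\<omega>. S \<omega> \<partial>M) \<le> 2 * K"
    unfolding S_def using ce_excess_bound[OF assms(2,5,6)] by auto
  \<comment> \<open>Cauchy-Schwarz over the pixels, the source of the dimension factor.\<close>
  have Z2: "(Z \<omega>)\<^sup>2 \<le> real CARD('d) * S \<omega>" for \<omega>
    unfolding Z_def S_def
    using sum_squared_le_sum_of_squares[of "\<lambda>j. \<bar>p (X \<omega>) $ j - q (X \<omega>) $ j\<bar>" UNIV]
    by (simp add: mult.commute)
  have intZ2: "integrable M (\<lambda>\<omega>. (Z \<omega>)\<^sup>2)"
    by (rule Bochner_Integration.integrable_bound[of _ "\<lambda>\<omega>. real CARD('d) * S \<omega>"])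
       (use S Z2 in \<open>auto intro!: AE_I2 intro: order_trans[OF _ abs_ge_self]\<close>)
  have intZ: "integrable M Z" by (rule square_integrable_imp_integrable[OF _ intZ2]) simp
  \<comment> \<open>Nonnegativity of the variance serves as the Cauchy-Schwarz inequality for the
    expectation.\<close>
  have "0 \<le> variance Z" by (rule variance_positive)
  then have "(\<integral>\<omega>. Z \<omega> \<partial>M)\<^sup>2 \<le> (\<integral>\<omega>. (Z \<omega>)\<^sup>2 \<partial>M)"
    using variance_eq[OF intZ intZ2] by simp
  also have "\<dots> \<le> (\<integral>\<omega>. real CARD('d) * S \<omega> \<partial>M)"
    using S Z2 intZ2 by (intro integral_mono) auto
  also have "\<dots> \<le> real CARD('d) * (2 * K)" using S by (simp add: mult_left_mono)
  finally have EZ: "(\<integral>\<omega>. Z \<omega> \<partial>M) \<le> sqrt (2 * real CARD('d) * K)"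
    by (intro real_le_rsqrt) (simp add: mult_ac)
  have \<delta>: "\<delta> \<in> seg_rules" by (rule rankdice_rule_seg_rules[OF assms(3)])
  have \<delta>s: "\<delta>s \<in> seg_rules" and max: "Dice \<gamma> M X Y \<delta> \<le> Dice \<gamma> M X Y \<delta>s"
    using assms(4) \<delta> by (auto simp: bayes_rule_def is_arg_max_linorder)
  note D = Dice_eq[OF assms(1) \<delta>] and Ds = Dice_eq[OF assms(1) \<delta>s]
  have "Dice \<gamma> M X Y \<delta>s - Dice \<gamma> M X Y \<delta> =
      (\<integral>\<omega>. expected_dice \<gamma> (p (X \<omega>)) (\<delta>s (X \<omega>)) - expected_dice \<gamma> (p (X \<omega>)) (\<delta> (X \<omega>)) \<partial>M)"
    using D Ds by simp
  also have "\<dots> \<le> (\<integral>\<omega>. 2 * Z \<omega> \<partial>M)"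
  proof (rule integral_mono_AE)
    show "AE \<omega> in M. expected_dice \<gamma> (p (X \<omega>)) (\<delta>s (X \<omega>)) - expected_dice \<gamma> (p (X \<omega>)) (\<delta> (X \<omega>)) \<le> 2 * Z \<omega>"
      using AE_prob_given_bit
    proof eventually_elim
      case (elim \<omega>)
      show ?case
        unfolding Z_def using elim \<delta> \<delta>s
        by (intro expected_dice_regret[OF assms(1-3)]) (auto simp: seg_rules_def)
    qed
  qed (use D Ds intZ in auto)
  also have "\<dots> \<le> 2 * sqrt (2 * real CARD('d) * K)" using EZ by simp
  finally show ?thesis using max by simp
qed

end

section \<open>The rate in probability\<close>

theorem corollary12:
  fixes M :: "'a measure" and S :: "'s measure"
    and X Y :: "'a \<Rightarrow> real ^ 'd::finite"
    and p \<delta>s :: "real ^ 'd \<Rightarrow> real ^ 'd"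
    and Xs Ys :: "nat \<Rightarrow> 's \<Rightarrow> real ^ 'd"
    and Q :: "nat \<Rightarrow> (real ^ 'd \<Rightarrow> real ^ 'd) set"
    and pen :: "nat \<Rightarrow> (real ^ 'd \<Rightarrow> real ^ 'd) \<Rightarrow> real"
    and lam \<epsilon> :: "nat \<Rightarrow> real"
    and qh \<delta>h :: "nat \<Rightarrow> 's \<Rightarrow> real ^ 'd \<Rightarrow> real ^ 'd"
    and \<gamma> :: real
  assumes "0 \<le> \<gamma>"
    and "prob_space M"
    and "X \<in> borel_measurable M" and "Y \<in> borel_measurable M"
    and "\<And>\<omega>. \<omega> \<in> space M \<Longrightarrow> Y \<omega> \<in> binary_vecs"
    and "cond_indep_vars M (gen_sigma M X) (\<lambda>j. borel) (\<lambda>j \<omega>. Y \<omega> $ j) UNIV"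
    and "cond_prob_version M X Y p"
    and "AE \<omega> in M. \<forall>i j. i \<noteq> j \<longrightarrow> p (X \<omega>) $ i \<noteq> p (X \<omega>) $ j"
    and "bayes_rule \<gamma> M X Y \<delta>s"
    and "prob_space S"
    and "\<And>i. Xs i \<in> borel_measurable S" and "\<And>i. Ys i \<in> borel_measurable S"
    and "\<And>i \<omega>. \<omega> \<in> space S \<Longrightarrow> Ys i \<omega> \<in> binary_vecs"
    and "\<And>n. Q n \<subseteq> candidates" and "\<And>n. 0 < lam n"
    and "\<And>n \<omega>. 1 \<le> n \<Longrightarrow> \<omega> \<in> space S \<Longrightarrow>
           rankdice \<gamma> (Q n) (pen n) (lam n) n (\<lambda>i. Xs i \<omega>) (\<lambda>i. Ys i \<omega>) (qh n \<omega>) (\<delta>h n \<omega>)"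
    and "\<And>n. 0 < \<epsilon> n"
    and "big_OP S (\<lambda>n \<omega>. ce_excess M X Y p (qh n \<omega>)) \<epsilon>"
  shows "big_OP S (\<lambda>n \<omega>. ereal (Dice \<gamma> M X Y \<delta>s - Dice \<gamma> M X Y (\<delta>h n \<omega>)))
           (\<lambda>n. sqrt (real CARD('d)) * sqrt (\<epsilon> n))"
proof -
  interpret prob_space M by fact
  interpret segmentation_model M X Y p
    using assms(3-7) by unfold_locales auto
  show ?thesis
    unfolding big_OP_def
  proof (intro allI impI)
    fix \<eta> :: real
    assume "0 < \<eta>"
    then obtain C where C: "0 < C"
      and ev: "\<forall>\<^sub>F n in sequentially. \<exists>A\<in>sets S.
        {\<omega> \<in> space S. ereal (C * \<epsilon> n) < \<bar>ce_excess M X Y p (qh n \<omega>)\<bar>} \<subseteq> A \<and> measure S A \<le> \<eta>"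
      using assms(18) unfolding big_OP_def by blast
    \<comment> \<open>\<open>Dice_regret\<close> with \<open>K = C * \<epsilon> n\<close> yields
      this constant once the dimension and \<open>\<epsilon> n\<close> are split off from the
      root.\<close>
    define C' where "C' = 2 * sqrt (2 * C)"
    have "\<forall>\<^sub>F n in sequentially. \<exists>A\<in>sets S.
        {\<omega> \<in> space S. ereal (C' * (sqrt (real CARD('d)) * sqrt (\<epsilon> n)))
          < \<bar>ereal (Dice \<gamma> M X Y \<delta>s - Dice \<gamma> M X Y (\<delta>h n \<omega>))\<bar>} \<subseteq> A \<and> measure S A \<le> \<eta>"
      using ev eventually_ge_at_top[of 1]
    proof eventually_elim
      case (elim n)
      then obtain A where A: "A \<in> sets S" "measure S A \<le> \<eta>"
        and sub: "{\<omega> \<in> space S. ereal (C * \<epsilon> n) < \<bar>ce_excess M X Y p (qh n \<omega>)\<bar>} \<subseteq> A"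
        by blast
      \<comment> \<open>Off the exceptional event \<open>A\<close> of the excess risk the regret
        bound is deterministic, so the same event serves for the conclusion.\<close>
      have "\<bar>Dice \<gamma> M X Y \<delta>s - Dice \<gamma> M X Y (\<delta>h n \<omega>)\<bar> \<le> C' * (sqrt (real CARD('d)) * sqrt (\<epsilon> n))"
        if \<omega>: "\<omega> \<in> space S" "\<omega> \<notin> A" for \<omega>
      proof -
        have rd: "qh n \<omega> \<in> candidates" "rankdice_rule \<gamma> (qh n \<omega>) (\<delta>h n \<omega>)"
          using assms(16)[OF elim(2) \<omega>(1)] assms(14)[of n]
          by (auto simp: rankdice_def is_arg_min_def)
        have "\<bar>ce_excess M X Y p (qh n \<omega>)\<bar> \<le> ereal (C * \<epsilon> n)"
          using sub \<omega> by (auto simp: not_less[symmetric])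
        then have "ce_excess M X Y p (qh n \<omega>) \<le> ereal (C * \<epsilon> n)"
          by (cases "ce_excess M X Y p (qh n \<omega>)") auto
        then have "\<bar>Dice \<gamma> M X Y \<delta>s - Dice \<gamma> M X Y (\<delta>h n \<omega>)\<bar>
            \<le> 2 * sqrt (2 * real CARD('d) * (C * \<epsilon> n))"
          using C assms(17)[of n] by (intro Dice_regret[OF assms(1) rd assms(9)]) auto
        also have "\<dots> = C' * (sqrt (real CARD('d)) * sqrt (\<epsilon> n))"
          by (simp add: C'_def real_sqrt_mult)
        finally show ?thesis .
      qed
      then have "{\<omega> \<in> space S. ereal (C' * (sqrt (real CARD('d)) * sqrt (\<epsilon> n)))
          < \<bar>ereal (Dice \<gamma> M X Y \<delta>s - Dice \<gamma> M X Y (\<delta>h n \<omega>))\<bar>} \<subseteq> A"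
        by (auto simp: not_less[symmetric])
      with A show ?case by blast
    qed
    moreover have "0 < C'" using C by (simp add: C'_def)
    ultimately show "\<exists>C>0. \<forall>\<^sub>F n in sequentially. \<exists>A\<in>sets S.
        {\<omega> \<in> space S. ereal (C * (sqrt (real CARD('d)) * sqrt (\<epsilon> n)))
          < \<bar>ereal (Dice \<gamma> M X Y \<delta>s - Dice \<gamma> M X Y (\<delta>h n \<omega>))\<bar>} \<subseteq> A \<and> measure S A \<le> \<eta>"
      by blast
  qed
qed

end
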